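(* Let $H$ be a hypergraph and let $(\mathcal{A}^T,[0,1]^{V(H)})$ be the random walk on $H$ whose probability transition matrix is the normalized adjacency matrix $\mathcal{A}$. For any pair of twin units $W_E,W_F\in\mathfrak{U}(H)$ with canonical bijection $f_{EF}:E\to F$, if $|W_E|=|W_F|$ then the random walk is forward invariant in $C_{W_E\cup W_F}$; that is, for every state $x\in[0,1]^{V(H)}$ with $x\in C_{W_E\cup W_F}$, one has $\mathcal{A}^Tx\in C_{W_E\cup W_F}$.
   Context: A hypergraph $H=(V(H),E(H))$ consists of a finite nonempty vertex set $V(H)$ and a finite family $E(H)$ of nonempty subsets of $V(H)$, called hyperedges. The star of a vertex $i$ is $E_i(H)=\{e\in E(H): i\in e\}$. So that $\mathcal{A}$ below is a well-defined probability transition matrix (rows summing to $1$), every vertex lies in at least one hyperedge and every hyperedge has at least two vertices. The normalized adjacency matrix $\mathcal{A}=(\mathcal{A}_{ij})_{i,j\in V(H)}$ is given by $\mathcal{A}_{ij}=\frac{1}{|E_i(H)|}\sum_{e\in E_i(H)\cap E_j(H)}\frac{1}{|e|-1}$ for $i\ne j$ and $\mathcal{A}_{ii}=0$. The random walk with transition matrix $\mathcal{A}$ has as its state at time $t$ the probability distribution $x_t:V(H)\to[0,1]$, evolving by $x_{t+1}=\mathcal{A}^Tx_t$. The units of $H$ are the equivalence classes of the relation $\{(i,j): E_i(H)=E_j(H)\}$ on $V(H)$; $\mathfrak{U}(H)$ is the set of all units. For a star $E$, $W_E=\{i\in V(H): E_i(H)=E\}$ is the unit generated by $E$. Two units $W_E,W_F$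 are twin units if the rule $f_{EF}(e)=(e\setminus W_E)\cup W_F$ defines a bijection $f_{EF}:E\to F$ (the canonical bijection). For $U\subseteq V(H)$, $C_U=\{x\in\mathbb{R}^{V(H)}: \text{there is } c_x\in\mathbb{R} \text{ with } x(i)=c_x \text{ for all } i\in U\}$. *)

theory Defs
  imports Complex_Main "HOL-Library.FuncSet"
begin

record 'a hypergraph =
  verts :: "'a set"
  hedges :: "'a set set"

definition hypergraph :: "'a hypergraph \<Rightarrow> bool" where
  "hypergraph H \<longleftrightarrow> finite (verts H) \<and> verts H \<noteq> {} \<and> finite (hedges H) \<and>
     (\<forall>e\<in>hedges H. e \<noteq> {} \<and> e \<subseteq> verts H)"

definition star :: "'a hypergraph \<Rightarrow> 'a \<Rightarrow> 'a set set" where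
  "star H i = {e \<in> hedges H. i \<in> e}"

text \<open>The standing assumption under which the normalized adjacency matrix is a probability
  transition matrix: neither of its denominators vanishes.\<close>

definition walkable :: "'a hypergraph \<Rightarrow> bool" where
  "walkable H \<longleftrightarrow> (\<forall>i\<in>verts H. star H i \<noteq> {}) \<and> (\<forall>e\<in>hedges H. 2 \<le> card e)"

definition adj_matrix :: "'a hypergraph \<Rightarrow> 'a \<Rightarrow> 'a \<Rightarrow> real" where
  "adj_matrix H i j =
     (if i = j then 0
      else 1 / real (card (star H i)) * (\<Sum>e\<in>star H i \<inter> star H j. 1 / (real (card e) - 1)))"

text \<open>Vectors indexed by a finite set \<open>V\<close> are the extensional functions on \<open>V\<close>,
  so that \<open>\<real>\<^sup>V\<close> is \<open>V \<rightarrow>\<^sub>E UNIV\<close>; matrices indexed by \<open>V \<times> V\<close> are curried functions of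
  which only the entries with both indices in \<open>V\<close> matter.\<close>

definition mat_transpose :: "('a \<Rightarrow> 'a \<Rightarrow> real) \<Rightarrow> 'a \<Rightarrow> 'a \<Rightarrow> real" where
  "mat_transpose M = (\<lambda>i j. M j i)"

definition mat_vec :: "'a set \<Rightarrow> ('a \<Rightarrow> 'a \<Rightarrow> real) \<Rightarrow> ('a \<Rightarrow> real) \<Rightarrow> 'a \<Rightarrow> real" where
  "mat_vec V M x = (\<lambda>i\<in>V. \<Sum>j\<in>V. M i j * x j)"

definition walk_step :: "'a hypergraph \<Rightarrow> ('a \<Rightarrow> real) \<Rightarrow> 'a \<Rightarrow> real" where
  "walk_step H = mat_vec (verts H) (mat_transpose (adj_matrix H))"

text \<open>The state space is the whole cube \<open>[0,1]\<^sup>V\<close>: states are not required to sum to 1.\<close>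

definition walk_states :: "'a hypergraph \<Rightarrow> ('a \<Rightarrow> real) set" where
  "walk_states H = verts H \<rightarrow>\<^sub>E {0..1}"

definition random_walk ::
    "'a hypergraph \<Rightarrow> (('a \<Rightarrow> real) \<Rightarrow> 'a \<Rightarrow> real) \<times> ('a \<Rightarrow> real) set" where
  "random_walk H = (walk_step H, walk_states H)"

definition forward_invariant :: "('s \<Rightarrow> 's) \<times> 's set \<Rightarrow> 's set \<Rightarrow> bool" where
  "forward_invariant D C \<longleftrightarrow> (case D of (f, X) \<Rightarrow> \<forall>x\<in>X. x \<in> C \<longrightarrow> f x \<in> C)"

definition star_rel :: "'a hypergraph \<Rightarrow> ('a \<times> 'a) set" where
  "star_rel H = {(i, j) \<in> verts H \<times> verts H. star H i = star H j}"

definition units :: "'a hypergraph \<Rightarrow> 'a set set" where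
  "units H = verts H // star_rel H"

definition stars :: "'a hypergraph \<Rightarrow> 'a set set set" where
  "stars H = star H ` verts H"

definition unit_of :: "'a hypergraph \<Rightarrow> 'a set set \<Rightarrow> 'a set" where
  "unit_of H E = {i \<in> verts H. star H i = E}"

definition canonical_map ::
    "'a hypergraph \<Rightarrow> 'a set set \<Rightarrow> 'a set set \<Rightarrow> 'a set \<Rightarrow> 'a set" where
  "canonical_map H E F e = (e - unit_of H E) \<union> unit_of H F"

text \<open>Units are given by their generating stars: \<open>unit_of H\<close> is injective on \<open>stars H\<close>.\<close>

definition twin_units :: "'a hypergraph \<Rightarrow> 'a set set \<Rightarrow> 'a set set \<Rightarrow> bool" where
  "twin_units H E F \<longleftrightarrow>
     E \<in> stars H \<and> F \<in> stars H \<and> bij_betw (canonical_map H E F) E F"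

definition const_on :: "'a hypergraph \<Rightarrow> 'a set \<Rightarrow> ('a \<Rightarrow> real) set" where
  "const_on H U = {x \<in> verts H \<rightarrow>\<^sub>E UNIV. \<exists>c. \<forall>i\<in>U. x i = c}"

end

theory Submission imports Defs
begin

text \<open>One step of the walk redistributes mass through the hyperedges: every vertex \<open>j\<close> puts
  the weight \<open>x j / card (star H j)\<close> on each hyperedge containing it, and each hyperedge \<open>e\<close>
  passes its total weight on to \<open>i \<in> e\<close>, minus the share of \<open>i\<close> itself, divided by
  \<open>card e - 1\<close>. The new value at \<open>i\<close> is therefore a sum over \<open>star H i\<close> whose terms involve
  \<open>i\<close> only through \<open>x i\<close> and its degree (\<open>walk_step_eq_edge_sum\<close>); in particular it is the
  same throughout a unit on which \<open>x\<close> is constant.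

  For twin units the canonical bijection exchanges, inside a hyperedge, one unit for the other.
  The stars of distinct twin units are disjoint (\<open>twin_units_stars_disjoint\<close>), so this
  exchange really is a replacement, and it preserves a sum over the hyperedge whenever the
  sums over the two units agree (\<open>sum_canonical_map\<close>). If the units have equal
  size, hyperedge sizes are thus preserved; if moreover \<open>x\<close> has the same value on both units,
  so are the weights, since the two stars, being in bijection, give equal degrees.
  Reindexing the sum over \<open>F\<close> along the bijection turns it into the sum over \<open>E\<close>.\<close>

lemma hyperedge_finite:
  assumes "hypergraph H" and "e \<in> hedges H"
  shows "finite e"
  using assms by (auto simp: hypergraph_def intro: finite_subset)

text \<open>The exchange of the two summations behind the redistribution picture. The subtracted
  term \<open>x i / card (star H i)\<close> comes from the zero diagonal of the adjacency matrix.\<close>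

lemma walk_step_eq_edge_sum:
  assumes H: "hypergraph H" and i: "i \<in> verts H"
  shows "walk_step H x i =
    (\<Sum>e\<in>star H i. ((\<Sum>j\<in>e. x j / card (star H j)) - x i / card (star H i)) / (real (card e) - 1))"
proof -
  let ?w = "\<lambda>j. x j / real (card (star H j))"
  let ?k = "\<lambda>e. 1 / (real (card e) - 1)"
  have finV: "finite (verts H)" and finS: "finite (star H i)"
    using H by (auto simp: hypergraph_def star_def)
  have entry: "adj_matrix H j i * x j = (\<Sum>e\<in>star H i. if j \<in> e - {i} then ?w j * ?k e else 0)"
    (is "_ = ?r") for j
  proof (cases "j = i")
    case True
    then show ?thesis by (simp add: adj_matrix_def)
  next
    case False
    have inter: "star H j \<inter> star H i = {e \<in> star H i. j \<in> e}"
      by (auto simp: star_def)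
    have "adj_matrix H j i * x j = ?w j * (\<Sum>e\<in>star H j \<inter> star H i. ?k e)"
      using False by (simp add: adj_matrix_def)
    also have "\<dots> = (\<Sum>e\<in>{e \<in> star H i. j \<in> e}. ?w j * ?k e)"
      unfolding inter by (rule sum_distrib_left)
    also have "\<dots> = (\<Sum>e\<in>star H i. if j \<in> e then ?w j * ?k e else 0)"
      by (rule sum.inter_filter[OF finS])
    also have "\<dots> = ?r"
      using False by (intro sum.cong) auto
    finally show ?thesis .
  qed
  have edge: "(\<Sum>j\<in>verts H. if j \<in> e - {i} then ?w j * ?k e else 0) = (sum ?w e - ?w i) * ?k e"
    if e: "e \<in> star H i" for e
  proof -
    have e': "e \<in> hedges H" "i \<in> e" using e by (auto simp: star_def)
    have "verts H \<inter> (e - {i}) = e - {i}"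
      using H e' by (auto simp: hypergraph_def)
    then have "(\<Sum>j\<in>verts H. if j \<in> e - {i} then ?w j * ?k e else 0) = (\<Sum>j\<in>e - {i}. ?w j * ?k e)"
      using sum.inter_restrict[OF finV, of "\<lambda>j. ?w j * ?k e" "e - {i}"] by simp
    also have "\<dots> = sum ?w (e - {i}) * ?k e"
      by (rule sum_distrib_right[symmetric])
    also have "sum ?w (e - {i}) = sum ?w e - ?w i"
      using hyperedge_finite[OF H e'(1)] e'(2) by (simp add: sum_diff1)
    finally show ?thesis .
  qed
  have "walk_step H x i = (\<Sum>j\<in>verts H. adj_matrix H j i * x j)"
    using i by (simp add: walk_step_def mat_vec_def mat_transpose_def)
  also have "\<dots> = (\<Sum>e\<in>star H i. \<Sum>j\<in>verts H. if j \<in> e - {i} then ?w j * ?k e else 0)"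
    unfolding entry by (rule sum.swap)
  also have "\<dots> = (\<Sum>e\<in>star H i. (sum ?w e - ?w i) * ?k e)"
    by (rule sum.cong[OF refl edge])
  finally show ?thesis by simp
qed

lemma unit_of_subset_hyperedge: "e \<in> E \<Longrightarrow> unit_of H E \<subseteq> e"
  by (auto simp: unit_of_def star_def)

text \<open>By surjectivity every hyperedge in \<open>F\<close> arises by removing \<open>unit_of H E\<close> and adding the
  disjoint set \<open>unit_of H F\<close>, so it misses the nonempty unit of \<open>E\<close> and cannot lie in \<open>E\<close>.\<close>

lemma twin_units_stars_disjoint:
  assumes twin: "twin_units H E F" and "E \<noteq> F"
  shows "E \<inter> F = {}"
proof -
  obtain i where i: "i \<in> unit_of H E"
    using twin by (auto simp: twin_units_def stars_def unit_of_def)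
  have "g \<notin> E" if "g \<in> F" for g
  proof -
    have "g \<in> canonical_map H E F ` E"
      using twin that by (simp add: twin_units_def bij_betw_def)
    then obtain e where "g = canonical_map H E F e" ..
    then have "i \<notin> g"
      using i \<open>E \<noteq> F\<close> by (auto simp: canonical_map_def unit_of_def)
    then show ?thesis
      using i unit_of_subset_hyperedge[of g E H] by blast
  qed
  then show ?thesis by blast
qed

text \<open>Applied with \<open>h = (\<lambda>_. 1)\<close> this says that sizes of hyperedges are preserved, and with
  \<open>h j = x j / card (star H j)\<close> that their total weights are.\<close>

lemma sum_canonical_map:
  fixes h :: "'a \<Rightarrow> 'b::comm_monoid_add"
  assumes H: "hypergraph H" and twin: "twin_units H E F" and e: "e \<in> E"
    and eq: "sum h (unit_of H E) = sum h (unit_of H F)"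
  shows "sum h (canonical_map H E F e) = sum h e"
proof (cases "E = F")
  case True
  then have "canonical_map H E F e = e"
    using unit_of_subset_hyperedge[OF e] by (auto simp: canonical_map_def)
  then show ?thesis by simp
next
  case False
  have "e \<in> hedges H"
    using twin e by (auto simp: twin_units_def stars_def star_def)
  then have fin: "finite e" by (rule hyperedge_finite[OF H])
  have finF: "finite (unit_of H F)"
    using H by (auto simp: hypergraph_def unit_of_def)
  have "e \<notin> F"
    using twin_units_stars_disjoint[OF twin False] e by blast
  then have disj: "(e - unit_of H E) \<inter> unit_of H F = {}"
    using \<open>e \<in> hedges H\<close> by (auto simp: unit_of_def star_def)
  have "sum h (canonical_map H E F e) = sum h (e - unit_of H E) + sum h (unit_of H F)"
    unfolding canonical_map_def using fin finF disj by (intro sum.union_disjoint) auto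
  also have "\<dots> = sum h e"
    unfolding eq[symmetric]
    by (rule sum.subset_diff[OF unit_of_subset_hyperedge[OF e] fin, symmetric])
  finally show ?thesis .
qed

theorem theorem3p4:
  fixes H :: "'a hypergraph" and E F :: "'a set set"
  assumes "hypergraph H" and "walkable H"
    and "unit_of H E \<in> units H" and "unit_of H F \<in> units H"
    and "twin_units H E F"
    and "card (unit_of H E) = card (unit_of H F)"
  shows "forward_invariant (random_walk H) (const_on H (unit_of H E \<union> unit_of H F))"
proof -
  note H = assms(1) and twin = assms(5) and same_size = assms(6)
  let ?U = "unit_of H E \<union> unit_of H F"
  have bij: "bij_betw (canonical_map H E F) E F"
    using twin by (simp add: twin_units_def)
  have degrees: "card E = card F"
    using bij by (rule bij_betw_same_card)
  have "walk_step H x \<in> const_on H ?U" if x: "x \<in> const_on H ?U" for x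
  proof -
    obtain c where c: "\<And>i. i \<in> ?U \<Longrightarrow> x i = c"
      using x unfolding const_on_def by blast
    define w where "w = (\<lambda>j. x j / real (card (star H j)))"
    define v where "v G = (\<Sum>e\<in>G. (sum w e - c / real (card G)) / (real (card e) - 1))" for G
    have step: "walk_step H x i = v G" if "i \<in> unit_of H G" "unit_of H G \<subseteq> ?U" for i G
    proof -
      have "i \<in> verts H" "star H i = G" "x i = c"
        using that c by (auto simp: unit_of_def)
      then show ?thesis
        using walk_step_eq_edge_sum[OF H, of i x] by (simp add: v_def w_def)
    qed
    have "w i = c / card E" if "i \<in> ?U" for i
    proof -
      have "star H i = E \<or> star H i = F"
        using that by (auto simp: unit_of_def)
      then show ?thesis
        unfolding w_def c[OF that] using degrees by metis
    qed
    then have "sum w (unit_of H E) = card (unit_of H E) * (c / card E)"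
      and "sum w (unit_of H F) = card (unit_of H F) * (c / card E)"
      by (simp_all cong: sum.cong_simp)
    then have weights: "sum w (unit_of H E) = sum w (unit_of H F)"
      by (simp only: same_size)
    have sizes: "card (canonical_map H E F e) = card e" if "e \<in> E" for e
      using sum_canonical_map[OF H twin that, of "\<lambda>_. 1::nat"] same_size by simp
    have "v F = (\<Sum>e\<in>E. (sum w (canonical_map H E F e) - c / real (card F))
                        / (real (card (canonical_map H E F e)) - 1))"
      unfolding v_def by (rule sum.reindex_bij_betw[OF bij, symmetric])
    also have "\<dots> = v E"
      unfolding v_def
      by (intro sum.cong refl) (simp add: sizes sum_canonical_map[OF H twin _ weights] degrees)
    finally have "v F = v E" .
    with step[of _ E] step[of _ F] have "\<forall>i\<in>?U. walk_step H x i = v E"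
      by (metis Un_iff Un_upper1 Un_upper2)
    moreover have "walk_step H x \<in> verts H \<rightarrow>\<^sub>E UNIV"
      by (simp add: walk_step_def mat_vec_def)
    ultimately show ?thesis
      unfolding const_on_def by blast
  qed
  then show ?thesis
    by (simp add: forward_invariant_def random_walk_def)
qed

end
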